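(* Let $\{x^{(l)}\}$ be the sequence generated by the proposed algorithm, i.e. $x^{(l)}=Q(x^{(l-1)})$ for $l\geq 1$, starting from a point $x^{(0)}\in\Omega$ with $f(x^{(0)})\le f(a^j)$ for every $j\in\{1,\dots,m\}$ with $a^j\in\Omega$. Then the sequence $\{f(x^{(l)})\}$ is non-increasing. Moreover, whenever $x^{(l)}\neq Q(x^{(l)})$, the sequence strictly decreases at the next iterate, i.e. $f(x^{(l+1)})<f(x^{(l)})$.
   Context: Throughout, $\|\cdot\|$ and $\langle\cdot,\cdot\rangle$ are the Euclidean norm and inner product on $\mathbb{R}^n$. $a^1,\dots,a^m\in\mathbb{R}^n$ are distinct, non-collinear points (the vertices), $w_1,\dots,w_m>0$ are weights, and $f(x)=\sum_{j=1}^m w_j\|x-a^j\|$. $\Omega\subset\mathbb{R}^n$ is nonempty, closed and convex, with orthogonal projection $P_\Omega:\mathbb{R}^n\to\Omega$. Define, for $x\in\mathbb{R}^n$: - $A(x)=\sum_{j=1}^m\frac{w_j}{2\|x-a^j\|}$ if $x\neq a^1,\dots,a^m$, and $A(a^k)=\sum_{j\neq k}\frac{w_j}{2\|a^k-a^j\|}$. - $\widetilde T(x)=\frac{1}{2A(x)}\sum_{j=1}^m\frac{w_ja^j}{\|x-a^j\|}$ if $x\neq a^1,\dots,a^m$, and $\widetilde T(a^k)=\frac{1}{2A(a^k)}\sum_{j\neq k}\frac{w_ja^j}{\|a^k-a^j\|}$. - $\widetilde R(x)=\sum_{j=1}^m\frac{w_j(a^j-x)}{\|x-a^j\|}$ if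 $x\neq a^1,\dots,a^m$, and $\widetilde R(a^k)=\sum_{j\neq k}\frac{w_j(a^j-a^k)}{\|a^k-a^j\|}$; $r(x)=\|\widetilde R(x)\|$. - $\gamma(x)=0$ if $x\neq a^1,\dots,a^m$; $\gamma(a^k)=0$ if $r(a^k)=0$; $\gamma(a^k)=w_k/r(a^k)$ if $r(a^k)\neq 0$. $\beta(x)=\min\{1,\gamma(x)\}$. - $T(x)=(1-\beta(x))\widetilde T(x)+\beta(x)x$. For $a^k\in\Omega$ let $\lambda(a^k)=\inf\{\lambda\in[0,1]:(1-\lambda)T(a^k)+\lambda a^k\in\Omega\}$. The iteration function $Q:\Omega\to\Omega$ is $Q(x)=P_\Omega(T(x))$ if $x\neq a^1,\dots,a^m$, and $Q(a^k)=(1-\lambda(a^k))T(a^k)+\lambda(a^k)a^k$ if $x=a^k\in\Omega$. (In practice the algorithm is stopped when $\|x^{(l)}-x^{(l-1)}\|<\varepsilon$ for a tolerance $\varepsilon>0$; the generated sequence is the sequence of iterates of $Q$.) *)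

theory Defs
  imports "HOL-Analysis.Analysis"
begin

text \<open>
  The vertices are \<open>a 1, \<dots>, a m\<close> with weights \<open>w 1, \<dots>, w m\<close>.
\<close>

definition vertices :: "nat \<Rightarrow> (nat \<Rightarrow> real ^ 'n) \<Rightarrow> (real ^ 'n) set" where
  "vertices m a = a ` {1..m}"

definition weber_f :: "nat \<Rightarrow> (nat \<Rightarrow> real ^ 'n) \<Rightarrow> (nat \<Rightarrow> real) \<Rightarrow> real ^ 'n \<Rightarrow> real" where
  "weber_f m a w x = (\<Sum>j=1..m. w j * norm (x - a j))"

text \<open>
  Range of the sums below: all of \<open>{1..m}\<close> if \<open>x\<close> is not a vertex, and, the vertices being
  distinct, \<open>{1..m} - {k}\<close> if \<open>x = a k\<close>; see the two lemmas that follow.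
\<close>

definition other_indices :: "nat \<Rightarrow> (nat \<Rightarrow> real ^ 'n) \<Rightarrow> real ^ 'n \<Rightarrow> nat set" where
  "other_indices m a x = {j \<in> {1..m}. a j \<noteq> x}"

lemma other_indices_nonvertex:
  "x \<notin> vertices m a \<Longrightarrow> other_indices m a x = {1..m}"
  unfolding other_indices_def vertices_def by blast

lemma other_indices_vertex:
  "inj_on a {1..m} \<Longrightarrow> k \<in> {1..m} \<Longrightarrow> other_indices m a (a k) = {1..m} - {k}"
  unfolding other_indices_def using inj_on_eq_iff [of a "{1..m}"] by blast

definition vertex_index :: "nat \<Rightarrow> (nat \<Rightarrow> real ^ 'n) \<Rightarrow> real ^ 'n \<Rightarrow> nat" where
  "vertex_index m a x = (THE k. k \<in> {1..m} \<and> a k = x)"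

lemma vertex_index_vertex:
  "inj_on a {1..m} \<Longrightarrow> k \<in> {1..m} \<Longrightarrow> vertex_index m a (a k) = k"
  unfolding vertex_index_def by (rule the_equality) (blast dest: inj_onD)+

definition weber_A :: "nat \<Rightarrow> (nat \<Rightarrow> real ^ 'n) \<Rightarrow> (nat \<Rightarrow> real) \<Rightarrow> real ^ 'n \<Rightarrow> real" where
  "weber_A m a w x = (\<Sum>j\<in>other_indices m a x. w j / (2 * norm (x - a j)))"

definition T_tilde ::
  "nat \<Rightarrow> (nat \<Rightarrow> real ^ 'n) \<Rightarrow> (nat \<Rightarrow> real) \<Rightarrow> real ^ 'n \<Rightarrow> real ^ 'n" where
  "T_tilde m a w x =
     (1 / (2 * weber_A m a w x)) *\<^sub>R
       (\<Sum>j\<in>other_indices m a x. (w j / norm (x - a j)) *\<^sub>R a j)"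

definition R_tilde ::
  "nat \<Rightarrow> (nat \<Rightarrow> real ^ 'n) \<Rightarrow> (nat \<Rightarrow> real) \<Rightarrow> real ^ 'n \<Rightarrow> real ^ 'n" where
  "R_tilde m a w x =
     (\<Sum>j\<in>other_indices m a x. (w j / norm (x - a j)) *\<^sub>R (a j - x))"

definition weber_r :: "nat \<Rightarrow> (nat \<Rightarrow> real ^ 'n) \<Rightarrow> (nat \<Rightarrow> real) \<Rightarrow> real ^ 'n \<Rightarrow> real" where
  "weber_r m a w x = norm (R_tilde m a w x)"

definition weber_gamma :: "nat \<Rightarrow> (nat \<Rightarrow> real ^ 'n) \<Rightarrow> (nat \<Rightarrow> real) \<Rightarrow> real ^ 'n \<Rightarrow> real" where
  "weber_gamma m a w x =
     (if x \<notin> vertices m a then 0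
      else if weber_r m a w x = 0 then 0
      else w (vertex_index m a x) / weber_r m a w x)"

definition weber_beta :: "nat \<Rightarrow> (nat \<Rightarrow> real ^ 'n) \<Rightarrow> (nat \<Rightarrow> real) \<Rightarrow> real ^ 'n \<Rightarrow> real" where
  "weber_beta m a w x = min 1 (weber_gamma m a w x)"

definition weber_T ::
  "nat \<Rightarrow> (nat \<Rightarrow> real ^ 'n) \<Rightarrow> (nat \<Rightarrow> real) \<Rightarrow> real ^ 'n \<Rightarrow> real ^ 'n" where
  "weber_T m a w x =
     (1 - weber_beta m a w x) *\<^sub>R T_tilde m a w x + weber_beta m a w x *\<^sub>R x"

text \<open>Only meaningful at vertices \<open>x\<close> lying in \<open>\<Omega>\<close>.\<close>

definition weber_lambda ::
  "nat \<Rightarrow> (nat \<Rightarrow> real ^ 'n) \<Rightarrow> (nat \<Rightarrow> real) \<Rightarrow> (real ^ 'n) set \<Rightarrow> real ^ 'n \<Rightarrow> real" where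
  "weber_lambda m a w \<Omega> x = Inf {t \<in> {0..1}. (1 - t) *\<^sub>R weber_T m a w x + t *\<^sub>R x \<in> \<Omega>}"

text \<open>
  The iteration function, meaningful for arguments in \<open>\<Omega>\<close>. For nonempty, closed and convex \<open>\<Omega>\<close>,
  \<open>closest_point \<Omega>\<close> is the orthogonal projection onto \<open>\<Omega>\<close>.
\<close>

definition weber_Q ::
  "nat \<Rightarrow> (nat \<Rightarrow> real ^ 'n) \<Rightarrow> (nat \<Rightarrow> real) \<Rightarrow> (real ^ 'n) set \<Rightarrow> real ^ 'n \<Rightarrow> real ^ 'n" where
  "weber_Q m a w \<Omega> x =
     (if x \<notin> vertices m a then closest_point \<Omega> (weber_T m a w x)
      else (1 - weber_lambda m a w \<Omega> x) *\<^sub>R weber_T m a w x + weber_lambda m a w \<Omega> x *\<^sub>R x)"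

end

theory Submission
  imports Defs
begin

text \<open>
  Everything follows from one quadratic majorant of the objective \<open>f = weber_f m a w\<close> at the
  current point \<open>x\<close>. For \<open>d = norm (x - a j) > 0\<close>, the inequality \<open>2 * d * u \<le> u\<^sup>2 + d\<^sup>2\<close>
  with \<open>u = norm (y - a j)\<close> bounds
  \<open>norm (y - a j)\<close> by a quadratic in \<open>y\<close> that agrees with it at \<open>x\<close>. Summing over the vertices
  other than \<open>x\<close>, and keeping the exact term \<open>v * norm (y - x)\<close> of the vertex at \<open>x\<close> (with
  \<open>v = 0\<close> if there is none), gives (lemma \<open>weber_f_majorant\<close>)
  \[ f(y) \le f(x) + A(x) \|y - x\|^2 - \langle \widetilde R(x), y - x\rangle + v \|y - x\|. \]
  Since \<open>T_tilde m a w x = x + R_tilde m a w x /\<^sub>R (2 * A)\<close>, the quadratic part is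
  \<open>A * ((norm (y - T_tilde m a w x))\<^sup>2 - (norm (x - T_tilde m a w x))\<^sup>2)\<close>.

  Away from the vertices, the next iterate is the point of \<open>\<Omega>\<close> closest to \<open>T_tilde m a w x\<close>. If it
  differs from \<open>x \<in> \<Omega>\<close> it is strictly closer than \<open>x\<close>, and the majorant is below \<open>f x\<close> there.

  At a vertex, the next iterate is \<open>x + s *\<^sub>R (T_tilde m a w x - x)\<close> with \<open>0 \<le> s \<le> 1 - \<beta>\<close>. Along
  this ray the majorant minus \<open>f x\<close> is \<open>s * r / (2 * A) * (s * r / 2 - (r - v))\<close>, where \<open>r\<close> is the
  norm of \<open>R_tilde m a w x\<close>. If the iterate moves, then \<open>s > 0\<close>, \<open>r > v\<close> and \<open>\<beta> = v / r\<close>, so that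
  \<open>s * r \<le> r - v\<close>, and the value is negative.

  In both cases a point of \<open>\<Omega>\<close> is sent to a point of \<open>\<Omega>\<close> and \<open>f\<close> drops strictly unless the point is
  fixed; induction along the iterates concludes.
\<close>

section \<open>The quadratic majorant\<close>

text \<open>
  The tangent of the square root at \<open>(norm (x - p))\<^sup>2\<close>, evaluated at \<open>(norm (y - p))\<^sup>2\<close>; concavity
  makes it an upper bound.
\<close>

lemma norm_le_quadratic_majorant:
  fixes x y p :: "'a :: real_inner"
  assumes "x \<noteq> p"
  shows "norm (y - p) \<le> norm (x - p) + (norm (y - x))\<^sup>2 / (2 * norm (x - p))
           - inner (p - x) (y - x) / norm (x - p)"
proof -
  define d where "d = norm (x - p)"
  define u where "u = norm (y - p)"
  have d: "d > 0"
    using assms by (simp add: d_def)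
  have "(norm ((x - p) + (y - x)))\<^sup>2
      = (norm (x - p))\<^sup>2 + 2 * inner (x - p) (y - x) + (norm (y - x))\<^sup>2"
    by (simp only: power2_norm_eq_inner inner_add_left inner_add_right)
      (simp add: inner_commute)
  moreover have "inner (x - p) (y - x) = - inner (p - x) (y - x)"
    by (simp add: inner_diff_left)
  ultimately have expand: "u\<^sup>2 = d\<^sup>2 - 2 * inner (p - x) (y - x) + (norm (y - x))\<^sup>2"
    by (simp add: u_def d_def)
  have "0 \<le> (u - d)\<^sup>2"
    by simp
  then have "2 * d * u \<le> 2 * d * d + (norm (y - x))\<^sup>2 - 2 * inner (p - x) (y - x)"
    using expand by (simp add: power2_eq_square algebra_simps)
  then have "u \<le> (2 * d * d + (norm (y - x))\<^sup>2 - 2 * inner (p - x) (y - x)) / (2 * d)"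
    using d by (simp add: pos_le_divide_eq mult.commute)
  also have "\<dots> = d + (norm (y - x))\<^sup>2 / (2 * d) - inner (p - x) (y - x) / d"
    using d by (simp add: field_simps)
  finally show ?thesis
    by (simp add: u_def d_def)
qed

text \<open>
  The weight carried by \<open>x\<close> itself. It separates the term of the objective that is not smooth at
  \<open>x\<close>, so that vertices and other points can share one majorant.
\<close>

definition own_weight :: "nat \<Rightarrow> (nat \<Rightarrow> real ^ 'n) \<Rightarrow> (nat \<Rightarrow> real) \<Rightarrow> real ^ 'n \<Rightarrow> real" where
  "own_weight m a w x = (if x \<in> vertices m a then w (vertex_index m a x) else 0)"

lemma weber_f_split:
  assumes "inj_on a {1..m}"
  shows "weber_f m a w y
    = (\<Sum>j\<in>other_indices m a x. w j * norm (y - a j)) + own_weight m a w x * norm (y - x)"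
proof (cases "x \<in> vertices m a")
  case False
  then show ?thesis
    by (simp add: weber_f_def own_weight_def other_indices_nonvertex)
next
  case True
  then obtain k where k: "k \<in> {1..m}" "x = a k"
    by (auto simp: vertices_def)
  have "weber_f m a w y = w k * norm (y - a k) + (\<Sum>j\<in>{1..m} - {k}. w j * norm (y - a j))"
    unfolding weber_f_def using k by (intro sum.remove) auto
  then show ?thesis
    using True k assms
    by (simp add: own_weight_def other_indices_vertex vertex_index_vertex)
qed

text \<open>Sum of the bounds of \<open>norm_le_quadratic_majorant\<close>; equality holds at \<open>y = x\<close>.\<close>

lemma weber_f_majorant:
  assumes inj: "inj_on a {1..m}" and w: "\<And>j. j \<in> {1..m} \<Longrightarrow> w j > 0"
  shows "weber_f m a w y \<le> weber_f m a w x + weber_A m a w x * (norm (y - x))\<^sup>2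
           - inner (R_tilde m a w x) (y - x) + own_weight m a w x * norm (y - x)"
proof -
  let ?J = "other_indices m a x"
  have "(\<Sum>j\<in>?J. w j * norm (y - a j))
      \<le> (\<Sum>j\<in>?J. w j * norm (x - a j) + w j / (2 * norm (x - a j)) * (norm (y - x))\<^sup>2
            - inner ((w j / norm (x - a j)) *\<^sub>R (a j - x)) (y - x))"
  proof (rule sum_mono)
    fix j assume "j \<in> ?J"
    then have j: "j \<in> {1..m}" "x \<noteq> a j"
      by (auto simp: other_indices_def)
    have "w j * norm (y - a j)
        \<le> w j * (norm (x - a j) + (norm (y - x))\<^sup>2 / (2 * norm (x - a j))
             - inner (a j - x) (y - x) / norm (x - a j))"
      using norm_le_quadratic_majorant[OF j(2)] w[OF j(1)]
      by (intro mult_left_mono) auto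
    then show "w j * norm (y - a j)
        \<le> w j * norm (x - a j) + w j / (2 * norm (x - a j)) * (norm (y - x))\<^sup>2
            - inner ((w j / norm (x - a j)) *\<^sub>R (a j - x)) (y - x)"
      by (simp only: distrib_left right_diff_distrib inner_scaleR_left
          times_divide_eq_right times_divide_eq_left)
  qed
  also have "\<dots> = (\<Sum>j\<in>?J. w j * norm (x - a j)) + weber_A m a w x * (norm (y - x))\<^sup>2
      - inner (R_tilde m a w x) (y - x)"
    by (simp only: sum.distrib sum_subtractf weber_A_def R_tilde_def sum_distrib_right
        inner_sum_left)
  finally show ?thesis
    using weber_f_split[OF inj, of w y x] weber_f_split[OF inj, of w x x] by simp
qed

section \<open>One step of the iteration\<close>

lemma weber_A_pos:
  assumes noncol: "\<not> collinear (vertices m a)" and w: "\<And>j. j \<in> {1..m} \<Longrightarrow> w j > 0"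
  shows "weber_A m a w x > 0"
  unfolding weber_A_def
proof (rule sum_pos)
  show "finite (other_indices m a x)"
    by (simp add: other_indices_def)
  show "other_indices m a x \<noteq> {}"
  proof
    assume "other_indices m a x = {}"
    then have "vertices m a \<subseteq> {x}"
      by (auto simp: other_indices_def vertices_def)
    then show False
      using noncol collinear_subset[OF collinear_sing] by blast
  qed
  show "0 < w j / (2 * norm (x - a j))" if "j \<in> other_indices m a x" for j
    using that w by (auto simp: other_indices_def)
qed

text \<open>
  The weighted average \<open>T_tilde\<close> is thus the gradient step \<open>x + R_tilde / (2 * A)\<close> for the part of
  the objective that is smooth at \<open>x\<close>; the coefficients \<open>w j / norm (x - a j)\<close> add up to \<open>2 * A\<close>.
\<close>

lemma R_tilde_eq:
  assumes "weber_A m a w x > 0"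
  shows "R_tilde m a w x = (2 * weber_A m a w x) *\<^sub>R (T_tilde m a w x - x)"
proof -
  have "2 * weber_A m a w x = (\<Sum>j\<in>other_indices m a x. w j / norm (x - a j))"
    unfolding weber_A_def sum_distrib_left by (intro sum.cong) auto
  moreover have "(2 * weber_A m a w x) *\<^sub>R T_tilde m a w x
      = (\<Sum>j\<in>other_indices m a x. (w j / norm (x - a j)) *\<^sub>R a j)"
    using assms by (simp add: T_tilde_def)
  ultimately show ?thesis
    by (simp add: R_tilde_def scaleR_diff_right sum_subtractf scaleR_sum_left)
qed

lemma weber_f_decreases_at_nonvertex:
  assumes inj: "inj_on a {1..m}" and noncol: "\<not> collinear (vertices m a)"
    and w: "\<And>j. j \<in> {1..m} \<Longrightarrow> w j > 0"
    and \<Omega>: "closed \<Omega>" "convex \<Omega>"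
    and x: "x \<in> \<Omega>" "x \<notin> vertices m a" and moves: "weber_Q m a w \<Omega> x \<noteq> x"
  shows "weber_f m a w (weber_Q m a w \<Omega> x) < weber_f m a w x"
proof -
  let ?A = "weber_A m a w x" and ?T = "T_tilde m a w x"
  define q where "q = weber_Q m a w \<Omega> x"
  have A: "?A > 0"
    using noncol w by (rule weber_A_pos)
  have q: "q = closest_point \<Omega> ?T"
    using x by (simp add: q_def weber_Q_def weber_T_def weber_beta_def weber_gamma_def)
  have "dist ?T q < dist ?T x"
    using closest_point_lt[OF \<Omega>(2,1) x(1)] moves q by (metis q_def)
  then have closer: "(norm (q - ?T))\<^sup>2 < (norm (x - ?T))\<^sup>2"
    by (simp add: dist_norm norm_minus_commute power_strict_mono)
  have "?A * (norm (q - x))\<^sup>2 - inner (R_tilde m a w x) (q - x)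
      = ?A * ((norm (q - ?T))\<^sup>2 - (norm (x - ?T))\<^sup>2)"
    unfolding R_tilde_eq[OF A]
    by (simp add: power2_norm_eq_inner inner_commute algebra_simps)
  also have "\<dots> < 0"
    using A closer by (simp add: mult_pos_neg)
  finally show ?thesis
    using weber_f_majorant[OF inj, of w q x] w x by (simp add: own_weight_def q_def)
qed

text \<open>
  The infimum defining \<open>weber_lambda\<close> is attained because \<open>\<Omega>\<close> is closed, and \<open>t = 1\<close> is admissible
  when \<open>x \<in> \<Omega>\<close>.
\<close>

lemma weber_lambda_admissible:
  assumes "closed \<Omega>" "x \<in> \<Omega>"
  shows "weber_lambda m a w \<Omega> x
    \<in> {t \<in> {0..1}. (1 - t) *\<^sub>R weber_T m a w x + t *\<^sub>R x \<in> \<Omega>}" (is "_ \<in> ?S")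
  unfolding weber_lambda_def
proof (rule closed_contains_Inf)
  have "1 \<in> ?S"
    using assms by simp
  then show "?S \<noteq> {}"
    by blast
  show "bdd_below ?S"
    by (rule bdd_belowI[of _ 0]) auto
  have "?S = {0..1} \<inter> (\<lambda>t. (1 - t) *\<^sub>R weber_T m a w x + t *\<^sub>R x) -` \<Omega>"
    by auto
  moreover have "closed \<dots>"
    by (intro closed_Int closed_vimage assms continuous_intros)
  ultimately show "closed ?S"
    by simp
qed

lemma weber_Q_in:
  assumes "closed \<Omega>" "x \<in> \<Omega>"
  shows "weber_Q m a w \<Omega> x \<in> \<Omega>"
  using weber_lambda_admissible[OF assms, of m a w] closest_point_in_set[OF assms(1)] assms(2)
  by (auto simp: weber_Q_def)

text \<open>
  The next iterate lies on the ray from the vertex in direction \<open>R_tilde\<close>. The relaxation \<open>\<beta>\<close>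
  shortens the step just enough for the gain along the ray to outweigh the vertex's own term
  \<open>v * norm (y - x)\<close>, and \<open>weber_lambda\<close> can only shorten it further.
\<close>

lemma weber_f_decreases_at_vertex:
  assumes inj: "inj_on a {1..m}" and noncol: "\<not> collinear (vertices m a)"
    and w: "\<And>j. j \<in> {1..m} \<Longrightarrow> w j > 0"
    and \<Omega>: "closed \<Omega>"
    and x: "x \<in> \<Omega>" "x \<in> vertices m a" and moves: "weber_Q m a w \<Omega> x \<noteq> x"
  shows "weber_f m a w (weber_Q m a w \<Omega> x) < weber_f m a w x"
proof -
  let ?R = "R_tilde m a w x" and ?T = "T_tilde m a w x"
  define A where "A = weber_A m a w x"
  define r where "r = weber_r m a w x"
  define v where "v = own_weight m a w x"
  define \<beta> where "\<beta> = weber_beta m a w x"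
  define t where "t = weber_lambda m a w \<Omega> x"
  define s where "s = (1 - t) * (1 - \<beta>)"
  define q where "q = weber_Q m a w \<Omega> x"
  have A: "A > 0"
    unfolding A_def using noncol w by (rule weber_A_pos)
  have R: "?R = (2 * A) *\<^sub>R (?T - x)"
    using R_tilde_eq[of m a w x] A by (simp add: A_def)
  have t: "0 \<le> t" "t \<le> 1"
    using weber_lambda_admissible[OF \<Omega> x(1), of m a w] by (auto simp: t_def)
  have "q = (1 - t) *\<^sub>R ((1 - \<beta>) *\<^sub>R ?T + \<beta> *\<^sub>R x) + t *\<^sub>R x"
    using x by (simp add: q_def weber_Q_def weber_T_def t_def \<beta>_def)
  then have q: "q - x = s *\<^sub>R (?T - x)"
    by (simp add: s_def algebra_simps)
  have moved: "s \<noteq> 0" "?T \<noteq> x"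
    using moves q by (auto simp flip: q_def)
  then have r: "r > 0"
    using R A by (simp add: r_def weber_r_def)
  have \<beta>: "\<beta> = min 1 (v / r)"
    using x r by (simp add: \<beta>_def r_def v_def weber_beta_def weber_gamma_def own_weight_def)
  have "\<beta> \<noteq> 1"
    using moved by (auto simp: s_def)
  then have "\<beta> = v / r" "v / r < 1"
    using \<beta> by auto
  then have v: "v < r" "r * (1 - \<beta>) = r - v"
    using r by (auto simp: field_simps)
  have \<beta>1: "1 - \<beta> \<ge> 0"
    using \<beta> by simp
  have s: "0 < s" "s * r \<le> r - v"
  proof -
    have "0 \<le> s"
      using t \<beta>1 by (simp add: s_def)
    then show "0 < s"
      using moved by simp
    have "s \<le> 1 - \<beta>"
      unfolding s_def using t \<beta>1 by (intro mult_left_le_one_le) auto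
    then show "s * r \<le> r - v"
      using r v(2) by (metis mult.commute mult_left_mono less_imp_le)
  qed
  have ray: "q - x = (s / (2 * A)) *\<^sub>R ?R"
    using q R A by simp
  have normq: "norm (q - x) = s * r / (2 * A)"
    unfolding ray using s A by (simp add: r_def weber_r_def)
  have innerq: "inner ?R (q - x) = s * r\<^sup>2 / (2 * A)"
    unfolding ray by (simp add: r_def weber_r_def power2_norm_eq_inner)
  have "A * (norm (q - x))\<^sup>2 - inner ?R (q - x) + v * norm (q - x)
      = s * r / (2 * A) * (s * r / 2 - (r - v))"
    unfolding normq innerq using A by (simp add: field_simps power2_eq_square)
  also have "\<dots> < 0"
    using s r A v by (intro mult_pos_neg) auto
  finally show ?thesis
    using weber_f_majorant[OF inj, of w q x] w by (simp add: A_def v_def q_def)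
qed

section \<open>Monotonicity along the iterates\<close>

theorem corollary18:
  fixes m :: nat
    and a :: "nat \<Rightarrow> real ^ 'n"
    and w :: "nat \<Rightarrow> real"
    and \<Omega> :: "(real ^ 'n) set"
    and x :: "nat \<Rightarrow> real ^ 'n"
  assumes distinct_vertices: "inj_on a {1..m}"
    and noncollinear: "\<not> collinear (vertices m a)"
    and weights_pos: "\<And>j. j \<in> {1..m} \<Longrightarrow> w j > 0"
    and \<Omega>: "\<Omega> \<noteq> {}" "closed \<Omega>" "convex \<Omega>"
    and start_in: "x 0 \<in> \<Omega>"
    and start_le: "\<And>j. j \<in> {1..m} \<Longrightarrow> a j \<in> \<Omega> \<Longrightarrow> weber_f m a w (x 0) \<le> weber_f m a w (a j)"
    and iterates: "\<And>l. l \<ge> 1 \<Longrightarrow> x l = weber_Q m a w \<Omega> (x (l - 1))"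
  shows "decseq (\<lambda>l. weber_f m a w (x l)) \<and>
    (\<forall>l. x l \<noteq> weber_Q m a w \<Omega> (x l) \<longrightarrow> weber_f m a w (x (l + 1)) < weber_f m a w (x l))"
proof -
  have step: "x (Suc l) = weber_Q m a w \<Omega> (x l)" for l
    using iterates[of "Suc l"] by simp
  have x_in: "x l \<in> \<Omega>" for l
    by (induction l) (use start_in weber_Q_in[OF \<Omega>(2)] step in auto)
  have strict: "weber_f m a w (x (Suc l)) < weber_f m a w (x l)"
    if "x l \<noteq> weber_Q m a w \<Omega> (x l)" for l
  proof (cases "x l \<in> vertices m a")
    case True
    show ?thesis
      unfolding step using distinct_vertices noncollinear weights_pos \<Omega>(2) x_in True that[symmetric]
      by (rule weber_f_decreases_at_vertex)
  next
    case False
    show ?thesis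
      unfolding step using distinct_vertices noncollinear weights_pos \<Omega>(2,3) x_in False that[symmetric]
      by (rule weber_f_decreases_at_nonvertex)
  qed
  have "weber_f m a w (x (Suc l)) \<le> weber_f m a w (x l)" for l
    using strict[of l] step[of l] by (cases "x l = weber_Q m a w \<Omega> (x l)") auto
  then show ?thesis
    using strict by (auto intro: decseq_SucI)
qed

end
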